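(* Let $G=(V,E)$ be a hypergraph and let $(U,\overline U)$ be a minimal balanced minimum $k$-partition split in $G$ for some integer $k\ge2$. Then for every vertex $u_0\in U$ there exist subsets $S\subseteq U\setminus\{u_0\}$ and $T\subseteq\overline U$ with $|S|\le 2k-3$ and $|T|\le 2k-2$ such that $(U,\overline U)$ is the source minimal minimum $(S\cup\{u_0\},T)$-terminal cut in $G$.
   Context: A hypergraph $G=(V,E)$ has finite vertex set $V$ and finite multiset $E$ of unit-cost hyperedges (subsets of $V$). For $X\subseteq V$, $\overline X=V\setminus X$ and $d(X)$ is the number of hyperedges meeting both $X$ and $\overline X$. The cost of an (ordered) partition of $V$ into non-empty parts is the number of hyperedges meeting at least two parts; a minimum $k$-partition is a $k$-partition of minimum cost. A 2-partition $(U,\overline U)$ is a balanced minimum $k$-partition split if there is a minimum $k$-partition $(V_1,\dots,V_k)$ with $U=\bigcup_{i=1}^{\lfloor k/2\rfloor}V_i$; it is minimal if there is no balanced minimum $k$-partition split $(U',\overline{U'})$ with $U'\subsetneq U$. For disjoint $S,T\subseteq V$, a 2-partition $(X,\overline X)$ is an $(S,T)$-terminal cut if $S\subseteq X\subseteq V\setminus T$; it is minimum if $d(X)$ is minimum among such cuts; the source minimal minimum $(S,T)$-terminal cut is the unique minimum one whose source set $X$ is inclusion-wise minimal. *)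

theory Defs
  imports Main "HOL-Library.Multiset"
begin

definition hypergraph :: "'a set \<Rightarrow> 'a set multiset \<Rightarrow> bool" where
  "hypergraph V E \<longleftrightarrow> finite V \<and> (\<forall>e\<in>#E. e \<subseteq> V)"

definition cut_deg :: "'a set \<Rightarrow> 'a set multiset \<Rightarrow> 'a set \<Rightarrow> nat" where
  "cut_deg V E X = size (filter_mset (\<lambda>e. e \<inter> X \<noteq> {} \<and> e \<inter> (V - X) \<noteq> {}) E)"

definition is_kpartition :: "'a set \<Rightarrow> nat \<Rightarrow> (nat \<Rightarrow> 'a set) \<Rightarrow> bool" where
  "is_kpartition V k P \<longleftrightarrow>
     (\<forall>i<k. P i \<noteq> {} \<and> P i \<subseteq> V) \<and>
     (\<forall>i<k. \<forall>j<k. i \<noteq> j \<longrightarrow> P i \<inter> P j = {}) \<and>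
     (\<Union>i<k. P i) = V"

definition part_cost :: "'a set multiset \<Rightarrow> nat \<Rightarrow> (nat \<Rightarrow> 'a set) \<Rightarrow> nat" where
  "part_cost E k P = size (filter_mset
     (\<lambda>e. \<exists>i<k. \<exists>j<k. i \<noteq> j \<and> e \<inter> P i \<noteq> {} \<and> e \<inter> P j \<noteq> {}) E)"

definition min_kpartition :: "'a set \<Rightarrow> 'a set multiset \<Rightarrow> nat \<Rightarrow> (nat \<Rightarrow> 'a set) \<Rightarrow> bool" where
  "min_kpartition V E k P \<longleftrightarrow> is_kpartition V k P \<and>
     (\<forall>Q. is_kpartition V k Q \<longrightarrow> part_cost E k P \<le> part_cost E k Q)"

definition balanced_split :: "'a set \<Rightarrow> 'a set multiset \<Rightarrow> nat \<Rightarrow> 'a set \<Rightarrow> bool" where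
  "balanced_split V E k U \<longleftrightarrow>
     (\<exists>P. min_kpartition V E k P \<and> U = (\<Union>i<k div 2. P i))"

definition minimal_balanced_split :: "'a set \<Rightarrow> 'a set multiset \<Rightarrow> nat \<Rightarrow> 'a set \<Rightarrow> bool" where
  "minimal_balanced_split V E k U \<longleftrightarrow> balanced_split V E k U \<and>
     \<not> (\<exists>U'. balanced_split V E k U' \<and> U' \<subset> U)"

definition terminal_cut :: "'a set \<Rightarrow> 'a set \<Rightarrow> 'a set \<Rightarrow> 'a set \<Rightarrow> bool" where
  "terminal_cut V S T X \<longleftrightarrow> S \<subseteq> X \<and> X \<subseteq> V - T"

definition min_terminal_cut :: "'a set \<Rightarrow> 'a set multiset \<Rightarrow> 'a set \<Rightarrow> 'a set \<Rightarrow> 'a set \<Rightarrow> bool" where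
  "min_terminal_cut V E S T X \<longleftrightarrow> terminal_cut V S T X \<and>
     (\<forall>Y. terminal_cut V S T Y \<longrightarrow> cut_deg V E X \<le> cut_deg V E Y)"

(* the source minimal minimum (S,T)-terminal cut: the minimum one whose source set
   is contained in the source set of every minimum (S,T)-terminal cut
   (this is the unique inclusion-wise minimal one) *)
definition source_minimal_min_terminal_cut ::
  "'a set \<Rightarrow> 'a set multiset \<Rightarrow> 'a set \<Rightarrow> 'a set \<Rightarrow> 'a set \<Rightarrow> bool" where
  "source_minimal_min_terminal_cut V E S T X \<longleftrightarrow> min_terminal_cut V E S T X \<and>
     (\<forall>Y. min_terminal_cut V E S T Y \<longrightarrow> X \<subseteq> Y)"

end

theory Submission
  imports Defs
begin

text \<open>
  Choose \<open>S \<subseteq> U - {u0}\<close> inclusion-wise minimal such that \<open>U\<close> is the source minimal minimum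
  \<open>(S \<union> {u0}, V - U)\<close>-terminal cut, and \<open>T \<subseteq> V - U\<close> inclusion-wise minimal such that \<open>U\<close> is a
  minimum \<open>(U, T)\<close>-terminal cut; submodularity combines the two properties. If \<open>S\<close> or \<open>T\<close> has at
  least \<open>p = 2 * k - 2\<close> elements, dropping each of \<open>p\<close> of them in turn yields minimum cuts
  \<open>A 0, \<dots>, A (p - 1)\<close>, of degree at most (for \<open>T\<close>: less than) that of \<open>U\<close>, such that every \<open>A i\<close>
  contains a vertex lying in no other \<open>A j\<close>. Isolating the sets of private vertices of either the
  first or the last \<open>k - 1\<close> of these cuts gives two \<open>k\<close>-partitions \<open>P\<close> and \<open>Q\<close>. With \<open>L j\<close> the set
  of vertices lying in at least \<open>j\<close> of the cuts, an edge-by-edge count shows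
  \<open>cost P + cost Q + (\<Sum>j = 3..p. d (L j)) \<le> (\<Sum>i < p. d (A i))\<close>. As \<open>d (L j) \<ge> d (A i)\<close> for
  \<open>j \<ge> 2\<close> by minimality of the cuts, one of \<open>P\<close> and \<open>Q\<close> costs at most the maximum of the
  \<open>d (A i)\<close>. For \<open>T\<close> this beats the optimum; for \<open>S\<close> it gives a balanced split strictly inside \<open>U\<close>.
\<close>

section \<open>Crossing edges and the layers of a family of cuts\<close>

definition crosses :: "'a set \<Rightarrow> 'a set \<Rightarrow> bool" where
  "crosses e X \<longleftrightarrow> e \<inter> X \<noteq> {} \<and> e - X \<noteq> {}"

definition members :: "nat \<Rightarrow> (nat \<Rightarrow> 'a set) \<Rightarrow> 'a \<Rightarrow> nat set" where
  "members p A v = {i. i < p \<and> v \<in> A i}"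

definition private_part :: "'a set \<Rightarrow> nat \<Rightarrow> (nat \<Rightarrow> 'a set) \<Rightarrow> nat \<Rightarrow> 'a set" where
  "private_part V p A i = {v \<in> V. members p A v = {i}}"

definition level_set :: "'a set \<Rightarrow> nat \<Rightarrow> (nat \<Rightarrow> 'a set) \<Rightarrow> nat \<Rightarrow> 'a set" where
  "level_set V p A j = {v \<in> V. j \<le> card (members p A v)}"

text \<open>The remainder gets the last index, which for \<open>k \<ge> 2\<close> keeps it out of
  the first \<open>k div 2\<close> parts that make up a balanced split.\<close>

definition isolating_partition :: "'a set \<Rightarrow> nat \<Rightarrow> (nat \<Rightarrow> 'a set) \<Rightarrow> nat \<Rightarrow> 'a set" where
  "isolating_partition V k Y i = (if i < k - 1 then Y i else V - (\<Union>j<k - 1. Y j))"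

lemma finite_members [simp]: "finite (members p A v)"
  by (simp add: members_def)

section \<open>Cut degrees and partition costs\<close>

lemma cut_deg_crosses:
  assumes "hypergraph V E"
  shows "cut_deg V E X = size (filter_mset (\<lambda>e. crosses e X) E)"
proof -
  have "filter_mset (\<lambda>e. e \<inter> X \<noteq> {} \<and> e \<inter> (V - X) \<noteq> {}) E = filter_mset (\<lambda>e. crosses e X) E"
    using assms by (intro filter_mset_cong refl) (auto simp: hypergraph_def crosses_def)
  then show ?thesis by (simp add: cut_deg_def)
qed

lemma cut_deg_complement: "X \<subseteq> V \<Longrightarrow> cut_deg V E (V - X) = cut_deg V E X"
  by (simp add: cut_deg_def double_diff conj_commute)

lemma size_filter_mset_conv_sum_mset:
  "size (filter_mset P E) = (\<Sum>e\<in>#E. of_bool (P e))"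
  by (induction E) auto

lemma size_filter_mset_mono:
  assumes "\<And>e. P e \<Longrightarrow> Q e"
  shows "size (filter_mset P E) \<le> size (filter_mset Q E)"
  unfolding size_filter_mset_conv_sum_mset by (intro sum_mset_mono) (use assms in auto)

text \<open>Double counting of pairs of an index and an edge, so that inequalities between sums of
  cut degrees can be checked for each edge alone.\<close>

lemma sum_size_filter_mset:
  assumes "finite I"
  shows "(\<Sum>i\<in>I. size (filter_mset (P i) E)) = (\<Sum>e\<in>#E. card {i \<in> I. P i e})"
proof (induction E)
  case (add e E)
  have "(\<Sum>i\<in>I. size (filter_mset (P i) (add_mset e E)))
      = (\<Sum>i\<in>I. size (filter_mset (P i) E) + of_bool (P i e))"
    by (intro sum.cong) auto
  then show ?case
    using add assms by (simp add: sum.distrib Int_def)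
qed simp

lemma cut_deg_submodular:
  assumes "hypergraph V E"
  shows "cut_deg V E (X \<inter> Y) + cut_deg V E (X \<union> Y) \<le> cut_deg V E X + cut_deg V E Y"
proof -
  have "of_bool (crosses e (X \<inter> Y)) + of_bool (crosses e (X \<union> Y))
      \<le> (of_bool (crosses e X) + of_bool (crosses e Y) :: nat)" for e
  proof -
    have "crosses e X \<and> crosses e Y" if "crosses e (X \<inter> Y)" "crosses e (X \<union> Y)"
      using that unfolding crosses_def by blast
    moreover have "crosses e X \<or> crosses e Y" if "crosses e (X \<inter> Y) \<or> crosses e (X \<union> Y)"
      using that unfolding crosses_def by blast
    ultimately show ?thesis
      by (cases "crosses e (X \<inter> Y)"; cases "crosses e (X \<union> Y)") auto
  qed
  then show ?thesis
    unfolding cut_deg_crosses[OF assms] size_filter_mset_conv_sum_mset sum_mset.distrib[symmetric]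
    by (rule sum_mset_mono)
qed

text \<open>An edge leaving the union of the first \<open>m\<close> parts meets one of them and one
  beyond. With \<open>m = k div 2\<close> this bounds the degree of a balanced split by the
  optimum.\<close>

lemma cut_deg_le_part_cost:
  assumes "is_kpartition V k P" and "m \<le> k"
  shows "cut_deg V E (\<Union>i<m. P i) \<le> part_cost E k P"
proof -
  have "\<exists>i<k. \<exists>j<k. i \<noteq> j \<and> e \<inter> P i \<noteq> {} \<and> e \<inter> P j \<noteq> {}"
    if e: "e \<inter> (\<Union>i<m. P i) \<noteq> {}" "e \<inter> (V - (\<Union>i<m. P i)) \<noteq> {}" for e
  proof -
    obtain i x where i: "i < m" "x \<in> e" "x \<in> P i" using e(1) by auto
    obtain y where y: "y \<in> e" "y \<in> V" "\<forall>i<m. y \<notin> P i" using e(2) by auto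
    then obtain j where j: "j < k" "y \<in> P j" using assms(1) by (auto simp: is_kpartition_def)
    have "i \<noteq> j" using i y j by auto
    then show ?thesis using i y j assms(2) by (intro exI[of _ i] exI[of _ j] conjI) auto
  qed
  then show ?thesis
    unfolding cut_deg_def part_cost_def by (intro size_filter_mset_mono) (elim conjE)
qed

lemma balanced_split_subset:
  assumes "balanced_split V E k U"
  shows "U \<subseteq> V"
proof -
  obtain P where P: "is_kpartition V k P" "U = (\<Union>i<k div 2. P i)"
    using assms by (auto simp: balanced_split_def min_kpartition_def)
  have "P i \<subseteq> V" if "i < k div 2" for i
  proof -
    have "i < k" using that by linarith
    then show ?thesis using P(1) by (simp add: is_kpartition_def)
  qed
  then show ?thesis unfolding P(2) by blast
qed

section \<open>Isolating partitions and the uncrossing count\<close>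

lemma isolating_partition_is_kpartition:
  assumes "k \<ge> 1"
    and "\<And>i. i < k - 1 \<Longrightarrow> Y i \<noteq> {} \<and> Y i \<subseteq> V"
    and "\<And>i j. i < k - 1 \<Longrightarrow> j < k - 1 \<Longrightarrow> i \<noteq> j \<Longrightarrow> Y i \<inter> Y j = {}"
    and "V - (\<Union>j<k - 1. Y j) \<noteq> {}"
  shows "is_kpartition V k (isolating_partition V k Y)"
proof -
  let ?P = "isolating_partition V k Y"
  have "V \<subseteq> (\<Union>i<k. ?P i)"
  proof
    fix v assume v: "v \<in> V"
    show "v \<in> (\<Union>i<k. ?P i)"
    proof (cases "\<exists>i<k - 1. v \<in> Y i")
      case True
      then obtain i where "i < k - 1" "v \<in> Y i" by blast
      then show ?thesis
        by (auto simp: isolating_partition_def intro!: bexI[of _ i])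
    next
      case False
      then show ?thesis
        using v assms(1) by (intro UN_I[of "k - 1"]) (auto simp: isolating_partition_def)
    qed
  qed
  moreover have "?P i \<subseteq> V" "?P i \<noteq> {}" for i
    using assms(2)[of i] assms(4) by (auto simp: isolating_partition_def)
  moreover have "?P i \<inter> ?P j = {}" if "i < k" "j < k" "i \<noteq> j" for i j
    using that assms(3)[of i j] by (auto simp: isolating_partition_def)
  ultimately show ?thesis
    unfolding is_kpartition_def by blast
qed

text \<open>Of two different parts at least one is not the remainder, and an edge meeting both
  crosses that isolated set.\<close>

lemma part_cost_isolating_partition:
  assumes "is_kpartition V k (isolating_partition V k Y)"
  shows "part_cost E k (isolating_partition V k Y)
     \<le> size (filter_mset (\<lambda>e. \<exists>i<k - 1. crosses e (Y i)) E)"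
proof -
  let ?P = "isolating_partition V k Y"
  have "\<exists>i<k - 1. crosses e (Y i)"
    if ij: "i < k" "j < k" "i \<noteq> j" "e \<inter> ?P i \<noteq> {}" "e \<inter> ?P j \<noteq> {}" for e i j
  proof -
    have "?P i \<inter> ?P j = {}" using assms ij by (simp add: is_kpartition_def)
    then have "crosses e (?P i)" "crosses e (?P j)" using ij by (auto simp: crosses_def)
    moreover have "i < k - 1 \<or> j < k - 1" using ij by linarith
    ultimately show ?thesis by (auto simp: isolating_partition_def)
  qed
  then show ?thesis
    unfolding part_cost_def by (intro size_filter_mset_mono) blast
qed

text \<open>A non-empty \<open>e\<close> crosses just the level sets above the lowest and up to the
  highest number of cuts containing one of its vertices. Leaving out levels 1 and 2 pays for the two
  isolating terms.\<close>

lemma crossing_count: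
  assumes "finite e" and "e \<subseteq> V"
  shows "of_bool (\<exists>i<k - 1. crosses e (private_part V p A i))
       + of_bool (\<exists>i<k - 1. crosses e (private_part V p A (k - 1 + i)))
       + card {j \<in> {3..p}. crosses e (level_set V p A j)}
      \<le> card {i \<in> {..<p}. crosses e (A i)}"
    (is "of_bool ?c1 + of_bool ?c2 + card ?J \<le> card ?I")
proof (cases "e = {}")
  case True
  then show ?thesis by (simp add: crosses_def)
next
  case False
  define N where "N = members p A"
  define lev where "lev v = card (N v)" for v
  have finN: "finite (N v)" for v by (simp add: N_def)
  have finI: "finite ?I" by simp
  obtain x where x: "x \<in> e" "\<And>v. v \<in> e \<Longrightarrow> lev v \<le> lev x"
    using Max_in[of "lev ` e"] Max_ge[of "lev ` e"] False assms(1) by fastforce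
  obtain y where y: "y \<in> e" "\<And>v. v \<in> e \<Longrightarrow> lev y \<le> lev v"
    using Min_in[of "lev ` e"] Min_le[of "lev ` e"] False assms(1) by fastforce
  have diff_sub: "N v - N w \<subseteq> ?I" if "v \<in> e" "w \<in> e" for v w
    using that by (auto simp: N_def members_def crosses_def)
  have "?J \<subseteq> {max 3 (lev y + 1)..lev x}"
  proof
    fix j assume "j \<in> ?J"
    then obtain v w where "3 \<le> j" "v \<in> e" "w \<in> e" "j \<le> lev v" "lev w < j"
      using assms(2) by (fastforce simp: crosses_def level_set_def lev_def N_def not_le)
    then show "j \<in> {max 3 (lev y + 1)..lev x}"
      using x(2)[of v] y(2)[of w] by auto
  qed
  from card_mono[OF _ this] have J: "card ?J \<le> lev x - max 2 (lev y)" by simp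
  have I1: "lev x - lev y \<le> card ?I"
    using diff_card_le_card_Diff[OF finN[of y], of "N x"] card_mono[OF finI diff_sub[OF x(1) y(1)]]
    by (simp add: lev_def)
  have isolated: "\<exists>v\<in>e. \<exists>w\<in>e. N v = {i} \<and> N w \<noteq> {i}"
    if cr: "crosses e (private_part V p A i)" for i
  proof -
    obtain v w where "v \<in> e" "v \<in> private_part V p A i" "w \<in> e" "w \<notin> private_part V p A i"
      using cr by (auto simp: crosses_def)
    then show ?thesis
      using assms(2) by (intro bexI[of _ v] bexI[of _ w]) (auto simp: private_part_def N_def)
  qed
  define c1 where "c1 \<longleftrightarrow> ?c1"
  define c2 where "c2 \<longleftrightarrow> ?c2"
  consider "\<not> c1" "\<not> c2" | "c1 \<noteq> c2" | "c1" "c2" by blast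
  then have "of_bool c1 + of_bool c2 + card ?J \<le> card ?I"
  proof cases
    case 1
    have "card ?J \<le> card ?I" using J I1 by linarith
    then show ?thesis using 1 by (simp only: of_bool_eq)
  next
    case 2
    then have "\<exists>i. crosses e (private_part V p A i)" unfolding c1_def c2_def by blast
    then obtain i v w where i: "v \<in> e" "w \<in> e" "N v = {i}" "N w \<noteq> {i}"
      using isolated by meson
    \<comment> \<open>Now \<open>?I\<close> has at least \<open>lev x - 1\<close> elements and
      \<open>?J\<close> at most \<open>lev x - 2\<close>. Subtraction is truncated, so for
      \<open>lev x \<le> 1\<close> the non-emptiness of \<open>?I\<close> is what gives the extra
      1.\<close>
    have lev: "lev y \<le> 1" using y(2)[OF i(1)] i by (simp add: lev_def)
    have "?I \<noteq> {}"
      using diff_sub[OF i(1,2)] diff_sub[OF i(2,1)] i(3,4) by blast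
    then have "1 \<le> card ?I" using finI by (metis One_nat_def Suc_leI card_gt_0_iff)
    then have "1 + card ?J \<le> card ?I" using J I1 lev by linarith
    then show ?thesis using 2 by (cases c1; cases c2) simp_all
  next
    case 3
    obtain i v where i: "i < k - 1" "v \<in> e" "N v = {i}"
      using 3(1) isolated unfolding c1_def by meson
    obtain j w where j: "k - 1 \<le> j" "w \<in> e" "N w = {j}"
      using 3(2) isolated unfolding c2_def by (meson le_add1)
    have "i \<noteq> j" using i j by simp
    \<comment> \<open>The singletons \<open>N v\<close> and \<open>N w\<close> are disjoint, so each
      cut containing \<open>z\<close> misses \<open>v\<close> or \<open>w\<close> and is crossed by
      \<open>e\<close>.\<close>
    have sub: "N z \<subseteq> ?I" if "z \<in> e" for z
    proof
      fix l assume "l \<in> N z"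
      then have "l \<in> N z - N v \<or> l \<in> N z - N w" using i j \<open>i \<noteq> j\<close> by auto
      then show "l \<in> ?I" using diff_sub[OF that i(2)] diff_sub[OF that j(2)] by blast
    qed
    have "{i, j} \<subseteq> ?I" using sub[OF i(2)] sub[OF j(2)] unfolding i(3) j(3) by blast
    then have "2 \<le> card ?I" using card_mono[OF finI, of "{i, j}"] \<open>i \<noteq> j\<close> by simp
    moreover have "lev x \<le> card ?I" using card_mono[OF finI sub[OF x(1)]] unfolding lev_def .
    ultimately have "2 + card ?J \<le> card ?I" using J by linarith
    then show ?thesis using 3 by simp
  qed
  then show ?thesis unfolding c1_def c2_def .
qed

text \<open>Common form of the source and sink arguments: \<open>B\<close> is a core shared by all
  cuts, \<open>u i\<close> witnesses that the private part of \<open>A i\<close> is non-empty, and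
  the last hypothesis is the optimality of the cuts.\<close>

lemma uncrossing_kpartition:
  assumes hyp: "hypergraph V E" and k: "k \<ge> 2" and p: "p = 2 * k - 2"
    and A: "\<And>i. i < p \<Longrightarrow> B \<subseteq> A i \<and> A i \<subseteq> V"
    and u: "\<And>i j. i < p \<Longrightarrow> j < p \<Longrightarrow> u i \<in> A j \<longleftrightarrow> i = j"
    and min: "\<And>i Y. i < p \<Longrightarrow> B \<subseteq> Y \<Longrightarrow> Y \<subseteq> V
      \<Longrightarrow> (\<And>v. v \<in> Y \<Longrightarrow> 2 \<le> card (members p A v)) \<Longrightarrow> cut_deg V E (A i) \<le> cut_deg V E Y"
  obtains P i where "is_kpartition V k P" "B \<subset> P (k - 1)" "i < p"
    "part_cost E k P \<le> cut_deg V E (A i)"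
proof -
  have p2: "2 \<le> p" using k p by simp
  define D where "D = Max ((\<lambda>i. cut_deg V E (A i)) ` {..<p})"
  have ne: "(\<lambda>i. cut_deg V E (A i)) ` {..<p} \<noteq> {}" using p2 by (auto simp: lessThan_empty_iff)
  have D_ge: "cut_deg V E (A i) \<le> D" if "i < p" for i
    unfolding D_def using that by (intro Max_ge) auto
  obtain m where m: "m < p" "cut_deg V E (A m) = D"
    using Max_in[OF _ ne] unfolding D_def by auto
  define Y where "Y f i = private_part V p A (f + i)" for f i
  define P where "P f = isolating_partition V k (Y f)" for f
  \<comment> \<open>Core vertices lie in all \<open>p \<ge> 2\<close> cuts, hence in no private
    part.\<close>
  have memB: "members p A v = {..<p}" if "v \<in> B" for v
    using A that by (auto simp: members_def)
  have uY: "u i \<in> private_part V p A i" if "i < p" for i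
    using that u A[of i] by (auto simp: private_part_def members_def)
  have kpart: "is_kpartition V k (P f) \<and> B \<subset> P f (k - 1)" if f: "f = 0 \<or> f = k - 1" for f
  proof -
    have lt: "f + i < p" if "i < k - 1" for i using f p that by auto
    \<comment> \<open>An index outside the isolated block \<open>f, ..., f + k - 2\<close>:
      \<open>u g\<close> falls into the remainder without lying in \<open>B\<close>, which makes the
      inclusion of \<open>B\<close> strict.\<close>
    define g where "g = k - 1 - f"
    have g: "g < p" "\<And>i. i < k - 1 \<Longrightarrow> f + i \<noteq> g" using f p k by (auto simp: g_def)
    have "u g \<in> V" using uY[OF g(1)] by (simp add: private_part_def)
    moreover have "u g \<notin> (\<Union>i<k - 1. Y f i)"
      using uY[OF g(1)] g(2) by (auto simp: Y_def private_part_def)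
    ultimately have ug: "u g \<in> P f (k - 1)"
      by (simp add: P_def isolating_partition_def)
    have "is_kpartition V k (P f)"
      unfolding P_def
    proof (rule isolating_partition_is_kpartition)
      show "Y f i \<noteq> {} \<and> Y f i \<subseteq> V" if "i < k - 1" for i
        using uY[OF lt[OF that]] by (auto simp: Y_def private_part_def)
      show "V - (\<Union>j<k - 1. Y f j) \<noteq> {}"
        using ug by (auto simp: P_def isolating_partition_def)
    qed (use k in \<open>auto simp: Y_def private_part_def\<close>)
    moreover have "B \<subseteq> P f (k - 1)"
    proof
      fix v assume "v \<in> B"
      then have "card (members p A v) = p" "v \<in> V" using memB A[OF m(1)] by auto
      then show "v \<in> P f (k - 1)"
        using p2 by (auto simp: P_def isolating_partition_def Y_def private_part_def)
    qed
    moreover have "u g \<notin> B"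
    proof
      assume "u g \<in> B"
      then have "card (members p A (u g)) = p" using memB by simp
      then show False using uY[OF g(1)] p2 by (simp add: private_part_def)
    qed
    ultimately show ?thesis using ug by blast
  qed
  have D_le: "D \<le> cut_deg V E (level_set V p A j)" if "j \<in> {3..p}" for j
    unfolding m(2)[symmetric]
  proof (rule min[OF m(1)])
    show "B \<subseteq> level_set V p A j"
      using that memB A[OF m(1)] by (auto simp: level_set_def)
  qed (use that in \<open>auto simp: level_set_def\<close>)
  have "part_cost E k (P 0) + part_cost E k (P (k - 1)) + (\<Sum>j=3..p. cut_deg V E (level_set V p A j))
     \<le> (\<Sum>i<p. cut_deg V E (A i))"
  proof -
    have "part_cost E k (P 0) + part_cost E k (P (k - 1)) + (\<Sum>j=3..p. cut_deg V E (level_set V p A j))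
      \<le> size (filter_mset (\<lambda>e. \<exists>i<k - 1. crosses e (private_part V p A i)) E)
       + size (filter_mset (\<lambda>e. \<exists>i<k - 1. crosses e (private_part V p A (k - 1 + i))) E)
       + (\<Sum>j=3..p. cut_deg V E (level_set V p A j))"
      using part_cost_isolating_partition[of V k "Y 0" E] kpart[of 0]
        part_cost_isolating_partition[of V k "Y (k - 1)" E] kpart[of "k - 1"]
      by (simp add: P_def Y_def)
    also have "\<dots> \<le> (\<Sum>i<p. cut_deg V E (A i))"
      unfolding cut_deg_crosses[OF hyp] sum_size_filter_mset[OF finite_atLeastAtMost]
        sum_size_filter_mset[OF finite_lessThan]
      unfolding size_filter_mset_conv_sum_mset sum_mset.distrib[symmetric]
    proof (rule sum_mset_mono, rule crossing_count)
      fix e assume "e \<in># E"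
      then show "e \<subseteq> V" "finite e" using hyp by (auto simp: hypergraph_def intro: finite_subset)
    qed
    finally show ?thesis .
  qed
  \<comment> \<open>The \<open>p - 2\<close> levels absorb at least \<open>(p - 2) * D\<close> of a
    total of at most \<open>p * D\<close>, so the two partitions share \<open>2 * D\<close>.\<close>
  moreover have "(p - 2) * D \<le> (\<Sum>j=3..p. cut_deg V E (level_set V p A j))"
    using sum_bounded_below[of "{3..p}" D, OF D_le] by simp
  moreover have "(\<Sum>i<p. cut_deg V E (A i)) \<le> p * D"
    using sum_bounded_above[of "{..<p}" "\<lambda>i. cut_deg V E (A i)" D] D_ge by simp
  moreover have "p * D = 2 * D + (p - 2) * D"
    using p2 by (metis add_mult_distrib le_add_diff_inverse)
  ultimately have "part_cost E k (P 0) + part_cost E k (P (k - 1)) \<le> 2 * D" by linarith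
  then obtain f where "f = 0 \<or> f = k - 1" "part_cost E k (P f) \<le> D"
  proof (cases "part_cost E k (P 0) \<le> D")
    case False
    then have "part_cost E k (P (k - 1)) \<le> D"
      using \<open>part_cost E k (P 0) + part_cost E k (P (k - 1)) \<le> 2 * D\<close> by linarith
    then show ?thesis using that by blast
  qed (use that in blast)
  then show thesis using that[of "P f" m] kpart m by auto
qed

section \<open>Thinning out the terminals\<close>

lemma ex_min_terminal_cut:
  assumes "terminal_cut V S T X"
  obtains Y where "min_terminal_cut V E S T Y"
  using ex_has_least_nat[of "terminal_cut V S T" X "cut_deg V E", OF assms]
  unfolding min_terminal_cut_def by blast

lemma card_ge2_members:
  assumes "2 \<le> card (members p A v)"
  obtains i j where "i < p" "j < p" "i \<noteq> j" "v \<in> A i" "v \<in> A j"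
proof -
  obtain M where "M \<subseteq> members p A v" "card M = 2"
    using assms by (meson obtain_subset_with_card_n)
  then show thesis using that by (auto simp: card_2_iff members_def)
qed

text \<open>A terminal in two cuts would equal two different \<open>u i\<close>. Hence sets of
  vertices lying in two cuts avoid all terminals and compete in every relaxed cut problem, on the
  source side through their complements.\<close>

lemma not_in_two_cuts:
  assumes "\<And>i. i < p \<Longrightarrow> A i \<inter> S \<subseteq> {u i}" and "inj_on u {..<p}"
    and "2 \<le> card (members p A v)"
  shows "v \<notin> S"
proof
  assume "v \<in> S"
  obtain i j where "i < p" "j < p" "i \<noteq> j" "v \<in> A i" "v \<in> A j"
    using assms(3) by (rule card_ge2_members)
  then show False
    using assms(1)[of i] assms(1)[of j] \<open>v \<in> S\<close> inj_onD[OF assms(2), of i j] by auto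
qed

lemma obtain_injection_into:
  assumes "n \<le> card S"
  obtains u :: "nat \<Rightarrow> 'a" where "inj_on u {..<n}" "\<And>i. i < n \<Longrightarrow> u i \<in> S"
proof -
  obtain M where M: "M \<subseteq> S" "card M = n" "finite M"
    using assms by (meson obtain_subset_with_card_n)
  then obtain u where "bij_betw u {..<n} M"
    using ex_bij_betw_nat_finite[of M] by (auto simp: lessThan_atLeast0)
  then show thesis using that[of u] M by (auto simp: bij_betw_def)
qed

lemma source_terminals:
  assumes hyp: "hypergraph V E" and k: "k \<ge> 2"
    and mbs: "minimal_balanced_split V E k U" and u0: "u0 \<in> U"
  obtains S where "S \<subseteq> U - {u0}" "card S \<le> 2 * k - 3"
    "source_minimal_min_terminal_cut V E (S \<union> {u0}) (V - U) U"
proof -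
  define good where
    "good S \<longleftrightarrow> S \<subseteq> U - {u0} \<and> source_minimal_min_terminal_cut V E (S \<union> {u0}) (V - U) U" for S
  obtain Q where Q: "min_kpartition V E k Q" "U = (\<Union>i<k div 2. Q i)"
    using mbs by (auto simp: minimal_balanced_split_def balanced_split_def)
  have UV: "U \<subseteq> V" using mbs unfolding minimal_balanced_split_def by (intro balanced_split_subset) (elim conjE)
  \<comment> \<open>With all of \<open>U\<close> as sources, \<open>U\<close> is the only feasible
    cut, so a good set exists.\<close>
  have "U - {u0} \<union> {u0} = U" using u0 by blast
  moreover have "Y = U" if "terminal_cut V U (V - U) Y" for Y
    using that UV by (auto simp: terminal_cut_def)
  moreover have "terminal_cut V U (V - U) U"
    using UV by (auto simp: terminal_cut_def)
  ultimately have "good (U - {u0})"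
    by (auto simp: good_def source_minimal_min_terminal_cut_def min_terminal_cut_def)
  then obtain S where S: "good S" "\<And>S'. good S' \<Longrightarrow> card S \<le> card S'"
    using ex_has_least_nat[of good _ card] by blast
  have SU: "S \<subseteq> U - {u0}" and smin: "source_minimal_min_terminal_cut V E (S \<union> {u0}) (V - U) U"
    using S(1) by (auto simp: good_def)
  have finS: "finite S" using SU UV hyp by (meson finite_Diff finite_subset hypergraph_def)
  have "card S < 2 * k - 2"
  proof (rule ccontr)
    define p where "p = 2 * k - 2"
    assume "\<not> card S < 2 * k - 2"
    then obtain u where u: "inj_on u {..<p}" "\<And>i. i < p \<Longrightarrow> u i \<in> S"
      using obtain_injection_into[of p S] unfolding p_def by auto
    have "\<exists>X. min_terminal_cut V E (S - {u i} \<union> {u0}) (V - U) X \<and> cut_deg V E X \<le> cut_deg V E U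
              \<and> u i \<notin> X" if i: "i < p" for i
    proof -
      have "card (S - {u i}) < card S" using finS u(2)[OF i] by (rule card_Diff1_less)
      then have "\<not> good (S - {u i})" using S(2)[of "S - {u i}"] by auto
      then have nsm: "\<not> source_minimal_min_terminal_cut V E (S - {u i} \<union> {u0}) (V - U) U"
        using SU by (auto simp: good_def)
      have tU: "terminal_cut V (S - {u i} \<union> {u0}) (V - U) U"
        using SU u0 UV by (auto simp: terminal_cut_def)
      obtain X0 where X0: "min_terminal_cut V E (S - {u i} \<union> {u0}) (V - U) X0"
        using tU by (rule ex_min_terminal_cut)
      \<comment> \<open>\<open>U\<close> fails either by not being minimum or by not lying inside
        some minimum cut. Both failures contradict \<open>smin\<close> once
        \<open>u i \<in> X\<close>.\<close>
      obtain X where X: "min_terminal_cut V E (S - {u i} \<union> {u0}) (V - U) X"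
        "cut_deg V E X < cut_deg V E U \<or> \<not> U \<subseteq> X"
      proof (cases "min_terminal_cut V E (S - {u i} \<union> {u0}) (V - U) U")
        case True
        then show ?thesis using nsm that by (auto simp: source_minimal_min_terminal_cut_def)
      next
        case False
        then have "cut_deg V E X0 < cut_deg V E U"
          using X0 tU by (meson le_trans min_terminal_cut_def not_less)
        then show ?thesis using X0 that by blast
      qed
      have le: "cut_deg V E X \<le> cut_deg V E U" using X(1) tU by (simp add: min_terminal_cut_def)
      have "u i \<notin> X"
      proof
        assume "u i \<in> X"
        then have t: "terminal_cut V (S \<union> {u0}) (V - U) X"
          using X(1) by (auto simp: min_terminal_cut_def terminal_cut_def)
        then have "min_terminal_cut V E (S \<union> {u0}) (V - U) X"
          using smin le by (meson le_trans min_terminal_cut_def source_minimal_min_terminal_cut_def)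
        then have "U \<subseteq> X" using smin by (simp add: source_minimal_min_terminal_cut_def)
        moreover have "cut_deg V E U \<le> cut_deg V E X"
          using t smin by (simp add: min_terminal_cut_def source_minimal_min_terminal_cut_def)
        ultimately show False using X(2) by simp
      qed
      then show ?thesis using X(1) le by blast
    qed
    then obtain X where X: "\<And>i. i < p \<Longrightarrow> min_terminal_cut V E (S - {u i} \<union> {u0}) (V - U) (X i)"
      "\<And>i. i < p \<Longrightarrow> cut_deg V E (X i) \<le> cut_deg V E U" "\<And>i. i < p \<Longrightarrow> u i \<notin> X i"
      by metis
    \<comment> \<open>The dropped terminal \<open>u i\<close> lies outside \<open>X i\<close>, so
      the complements are the cuts with private vertices, and their core is
      \<open>V - U\<close>.\<close>
    define A where "A i = V - X i" for i
    have Xt: "S - {u i} \<union> {u0} \<subseteq> X i" "X i \<subseteq> U" if "i < p" for i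
      using X(1)[OF that] by (auto simp: min_terminal_cut_def terminal_cut_def)
    have XV: "X i \<subseteq> V" if "i < p" for i using Xt(2)[OF that] UV by blast
    have AS: "A i \<inter> (S \<union> {u0}) \<subseteq> {u i}" if "i < p" for i
      using Xt(1)[OF that] by (auto simp: A_def)
    have dA: "cut_deg V E (A i) = cut_deg V E (X i)" if "i < p" for i
      using XV[OF that] by (simp add: A_def cut_deg_complement)
    obtain P i where P: "is_kpartition V k P" "V - U \<subset> P (k - 1)" "i < p"
      "part_cost E k P \<le> cut_deg V E (A i)"
    proof (rule uncrossing_kpartition[OF hyp k p_def, of "V - U" A u])
      show "V - U \<subseteq> A i \<and> A i \<subseteq> V" if "i < p" for i
        using Xt(2)[OF that] by (auto simp: A_def)
      show "u i \<in> A j \<longleftrightarrow> i = j" if "i < p" "j < p" for i j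
      proof
        assume "u i \<in> A j"
        then have "u i = u j" using AS[OF that(2)] u(2)[OF that(1)] by auto
        then show "i = j" using u(1) that by (auto dest: inj_onD)
      next
        assume "i = j"
        then show "u i \<in> A j" using X(3)[OF that(1)] u(2)[OF that(1)] SU UV by (auto simp: A_def)
      qed
      show "cut_deg V E (A i) \<le> cut_deg V E Y"
        if i: "i < p" and Y: "V - U \<subseteq> Y" "Y \<subseteq> V" "\<And>v. v \<in> Y \<Longrightarrow> 2 \<le> card (members p A v)" for i Y
      proof -
        have "Y \<inter> (S \<union> {u0}) = {}"
          using not_in_two_cuts[of p A "S \<union> {u0}" u, OF AS u(1) Y(3)] by blast
        then have "terminal_cut V (S - {u i} \<union> {u0}) (V - U) (V - Y)"
          using Y(1) SU UV u0 by (auto simp: terminal_cut_def)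
        then have "cut_deg V E (X i) \<le> cut_deg V E (V - Y)"
          using X(1)[OF i] by (simp add: min_terminal_cut_def)
        then show ?thesis using dA[OF i] Y(2) by (simp add: cut_deg_complement)
      qed
    qed
    \<comment> \<open>Only a weak inequality holds, as \<open>U\<close> may still be minimum; it
      makes \<open>P\<close> optimal, and the contradiction comes from the minimality of the
      split.\<close>
    have "part_cost E k P \<le> cut_deg V E U" using P(3,4) dA X(2) by (metis le_trans)
    also have "\<dots> \<le> part_cost E k Q"
      using Q cut_deg_le_part_cost[of V k Q "k div 2" E] by (simp add: min_kpartition_def)
    finally have "min_kpartition V E k P"
      using P(1) Q(1) by (meson le_trans min_kpartition_def)
    then have "balanced_split V E k (\<Union>i<k div 2. P i)" by (auto simp: balanced_split_def)
    moreover have "(\<Union>i<k div 2. P i) \<subset> U"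
    proof -
      \<comment> \<open>The first \<open>k div 2\<close> parts avoid the last part, which strictly
        contains \<open>V - U\<close>, so their union is strictly inside \<open>U\<close>.\<close>
      have lt: "i < k - 1" if "i < k div 2" for i using that k by auto
      have "P i \<subseteq> V - P (k - 1)" if "i < k - 1" for i
      proof -
        have "i < k" "k - 1 < k" "i \<noteq> k - 1" using that by auto
        then have "P i \<inter> P (k - 1) = {}" "P i \<subseteq> V"
          using P(1) unfolding is_kpartition_def by blast+
        then show ?thesis by blast
      qed
      then have "(\<Union>i<k div 2. P i) \<subseteq> V - P (k - 1)" using lt by blast
      moreover have "P (k - 1) \<subseteq> V" using P(1) k by (simp add: is_kpartition_def)
      ultimately show ?thesis using P(2) UV by blast
    qed
    ultimately show False using mbs by (auto simp: minimal_balanced_split_def)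
  qed
  then show thesis using that[OF SU _ smin] by linarith
qed

text \<open>With all of \<open>U\<close> as source the cuts themselves share the core
  \<open>U\<close>. Only minimality of \<open>U\<close> is preserved while thinning, so each failure
  yields a strictly cheaper cut, and too many sinks yield a partition below the optimum.\<close>

lemma sink_terminals:
  assumes hyp: "hypergraph V E" and k: "k \<ge> 2" and bs: "balanced_split V E k U"
  obtains T where "T \<subseteq> V - U" "card T \<le> 2 * k - 3" "min_terminal_cut V E U T U"
proof -
  define good where "good T \<longleftrightarrow> T \<subseteq> V - U \<and> min_terminal_cut V E U T U" for T
  obtain Q where Q: "min_kpartition V E k Q" "U = (\<Union>i<k div 2. Q i)"
    using bs by (auto simp: balanced_split_def)
  have UV: "U \<subseteq> V" using bs by (rule balanced_split_subset)
  have "Y = U" if "terminal_cut V U (V - U) Y" for Y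
    using that UV by (auto simp: terminal_cut_def)
  moreover have "terminal_cut V U (V - U) U"
    using UV by (auto simp: terminal_cut_def)
  ultimately have "good (V - U)"
    by (auto simp: good_def min_terminal_cut_def)
  then obtain T where T: "good T" "\<And>T'. good T' \<Longrightarrow> card T \<le> card T'"
    using ex_has_least_nat[of good _ card] by blast
  have TU: "T \<subseteq> V - U" and tmin: "min_terminal_cut V E U T U"
    using T(1) by (auto simp: good_def)
  have finT: "finite T" using TU hyp by (meson finite_Diff finite_subset hypergraph_def)
  have "card T < 2 * k - 2"
  proof (rule ccontr)
    define p where "p = 2 * k - 2"
    assume "\<not> card T < 2 * k - 2"
    then obtain u where u: "inj_on u {..<p}" "\<And>i. i < p \<Longrightarrow> u i \<in> T"
      using obtain_injection_into[of p T] unfolding p_def by auto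
    have "\<exists>X. min_terminal_cut V E U (T - {u i}) X \<and> cut_deg V E X < cut_deg V E U \<and> u i \<in> X"
      if i: "i < p" for i
    proof -
      have "card (T - {u i}) < card T" using finT u(2)[OF i] by (rule card_Diff1_less)
      then have "\<not> good (T - {u i})" using T(2)[of "T - {u i}"] by auto
      then have nm: "\<not> min_terminal_cut V E U (T - {u i}) U"
        using TU by (auto simp: good_def)
      have tU: "terminal_cut V U (T - {u i}) U"
        using TU UV by (auto simp: terminal_cut_def)
      obtain X where X: "min_terminal_cut V E U (T - {u i}) X"
        using tU by (rule ex_min_terminal_cut)
      have lt: "cut_deg V E X < cut_deg V E U"
        using X nm tU by (meson le_trans min_terminal_cut_def not_less)
      have "u i \<in> X"
      proof (rule ccontr)
        assume "u i \<notin> X"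
        then have "terminal_cut V U T X"
          using X by (auto simp: min_terminal_cut_def terminal_cut_def)
        then show False using tmin lt by (meson min_terminal_cut_def not_less)
      qed
      then show ?thesis using X lt by blast
    qed
    then obtain A where A: "\<And>i. i < p \<Longrightarrow> min_terminal_cut V E U (T - {u i}) (A i)"
      "\<And>i. i < p \<Longrightarrow> cut_deg V E (A i) < cut_deg V E U" "\<And>i. i < p \<Longrightarrow> u i \<in> A i"
      by metis
    have At: "U \<subseteq> A i" "A i \<subseteq> V - (T - {u i})" if "i < p" for i
      using A(1)[OF that] by (auto simp: min_terminal_cut_def terminal_cut_def)
    have AT: "A i \<inter> T \<subseteq> {u i}" if "i < p" for i
      using At(2)[OF that] by auto
    obtain P i where P: "is_kpartition V k P" "i < p" "part_cost E k P \<le> cut_deg V E (A i)"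
    proof (rule uncrossing_kpartition[OF hyp k p_def, of U A u])
      show "U \<subseteq> A i \<and> A i \<subseteq> V" if "i < p" for i
        using At[OF that] by auto
      show "u i \<in> A j \<longleftrightarrow> i = j" if "i < p" "j < p" for i j
      proof
        assume "u i \<in> A j"
        then have "u i = u j" using AT[OF that(2)] u(2)[OF that(1)] by auto
        then show "i = j" using u(1) that by (auto dest: inj_onD)
      qed (use A(3) that in auto)
      show "cut_deg V E (A i) \<le> cut_deg V E Y"
        if i: "i < p" and Y: "U \<subseteq> Y" "Y \<subseteq> V" "\<And>v. v \<in> Y \<Longrightarrow> 2 \<le> card (members p A v)" for i Y
      proof -
        have "Y \<inter> T = {}"
          using not_in_two_cuts[of p A T u, OF AT u(1) Y(3)] by blast
        then have "terminal_cut V U (T - {u i}) Y"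
          using Y by (auto simp: terminal_cut_def)
        then show ?thesis using A(1)[OF i] by (simp add: min_terminal_cut_def)
      qed
    qed
    note P(3)
    also have "cut_deg V E (A i) < cut_deg V E U" using A(2) P(2) by blast
    also have "\<dots> \<le> part_cost E k Q"
      using Q cut_deg_le_part_cost[of V k Q "k div 2" E] by (simp add: min_kpartition_def)
    also have "\<dots> \<le> part_cost E k P" using P(1) Q(1) by (simp add: min_kpartition_def)
    finally show False by simp
  qed
  then show thesis using that[OF TU _ tmin] by linarith
qed

text \<open>For a competitor \<open>Y\<close>, the union \<open>U \<union> Y\<close> is a
  \<open>(U, T)\<close>-cut and so costs at least as much as \<open>U\<close>. Submodularity then
  makes \<open>U \<inter> Y\<close>, an \<open>(S, V - U)\<close>-cut, no costlier than
  \<open>Y\<close>.\<close>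

lemma source_minimal_min_terminal_cut_combine:
  assumes hyp: "hypergraph V E" and T: "T \<subseteq> V - U"
    and smin: "source_minimal_min_terminal_cut V E S (V - U) U"
    and tmin: "min_terminal_cut V E U T U"
  shows "source_minimal_min_terminal_cut V E S T U"
proof -
  have SU: "S \<subseteq> U" "U \<subseteq> V"
    using smin by (auto simp: source_minimal_min_terminal_cut_def min_terminal_cut_def terminal_cut_def)
  have U: "terminal_cut V S T U" using SU T by (auto simp: terminal_cut_def)
  have ineq: "cut_deg V E (U \<inter> Y) + cut_deg V E U \<le> cut_deg V E U + cut_deg V E Y"
    and inter: "terminal_cut V S (V - U) (U \<inter> Y)" if "terminal_cut V S T Y" for Y
  proof -
    show "terminal_cut V S (V - U) (U \<inter> Y)"
      using that SU by (auto simp: terminal_cut_def)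
    have "terminal_cut V U T (U \<union> Y)"
      using that SU T by (auto simp: terminal_cut_def)
    then have "cut_deg V E U \<le> cut_deg V E (U \<union> Y)"
      using tmin by (simp add: min_terminal_cut_def)
    then show "cut_deg V E (U \<inter> Y) + cut_deg V E U \<le> cut_deg V E U + cut_deg V E Y"
      using cut_deg_submodular[OF hyp, of U Y] by linarith
  qed
  have le: "cut_deg V E U \<le> cut_deg V E (U \<inter> Y)" if "terminal_cut V S T Y" for Y
    using smin inter[OF that]
    by (simp add: source_minimal_min_terminal_cut_def min_terminal_cut_def)
  have "min_terminal_cut V E S T U"
    unfolding min_terminal_cut_def
  proof (intro conjI allI impI U)
    fix Y assume "terminal_cut V S T Y"
    from ineq[OF this] le[OF this] show "cut_deg V E U \<le> cut_deg V E Y" by linarith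
  qed
  moreover have "U \<subseteq> Y" if Y: "min_terminal_cut V E S T Y" for Y
  proof -
    have t: "terminal_cut V S T Y" and "cut_deg V E Y \<le> cut_deg V E U"
      using Y U by (auto simp: min_terminal_cut_def)
    then have "cut_deg V E (U \<inter> Y) \<le> cut_deg V E U" using ineq[OF t] by linarith
    \<comment> \<open>Source minimality with respect to \<open>V - U\<close> now forces
      \<open>U\<close> into \<open>U \<inter> Y\<close>.\<close>
    then have "min_terminal_cut V E S (V - U) (U \<inter> Y)"
      using smin inter[OF t]
      by (meson le_trans min_terminal_cut_def source_minimal_min_terminal_cut_def)
    then show ?thesis using smin by (auto simp: source_minimal_min_terminal_cut_def)
  qed
  ultimately show ?thesis by (simp add: source_minimal_min_terminal_cut_def)
qed

theorem theorem5p3: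
  fixes V :: "'a set" and E :: "'a set multiset" and k :: nat and U :: "'a set"
  assumes "hypergraph V E"
    and "k \<ge> 2"
    and "minimal_balanced_split V E k U"
  shows "\<forall>u0\<in>U. \<exists>S T. S \<subseteq> U - {u0} \<and> T \<subseteq> V - U \<and>
           card S \<le> 2 * k - 3 \<and> card T \<le> 2 * k - 2 \<and>
           source_minimal_min_terminal_cut V E (S \<union> {u0}) T U"
proof
  fix u0 assume "u0 \<in> U"
  obtain S where S: "S \<subseteq> U - {u0}" "card S \<le> 2 * k - 3"
    "source_minimal_min_terminal_cut V E (S \<union> {u0}) (V - U) U"
    using source_terminals[OF assms \<open>u0 \<in> U\<close>] .
  have "balanced_split V E k U" using assms(3) by (simp add: minimal_balanced_split_def)
  then obtain T where T: "T \<subseteq> V - U" "card T \<le> 2 * k - 3" "min_terminal_cut V E U T U"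
    using sink_terminals[OF assms(1,2)] by blast
  have "source_minimal_min_terminal_cut V E (S \<union> {u0}) T U"
    using assms(1) T(1) S(3) T(3) by (rule source_minimal_min_terminal_cut_combine)
  then show "\<exists>S T. S \<subseteq> U - {u0} \<and> T \<subseteq> V - U \<and> card S \<le> 2 * k - 3 \<and> card T \<le> 2 * k - 2 \<and>
      source_minimal_min_terminal_cut V E (S \<union> {u0}) T U"
    using S T by (intro exI[of _ S] exI[of _ T]) auto
qed

end
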